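(* Let $0<m<n$. The asymptotic average train frequency of the max-plus linear system with demand-dependent dwell times and controlled run times on a linear line, $$d^k_j=\max\left\{d^{k-b_j}_{j-1}+\tilde r_j+X_j\underline g_j,\ \ d^{k-\bar b_{j+1}}_{j+1}+\underline s_{j+1}\right\},$$ is a function of the number of trains $m$ and of the passenger travel demand $X=(X_j)_j$: $$f(m,X)=\min\left\{\frac{m}{\sum_j(\underline g_jX_j+\tilde r_j)},\ \ \frac{1}{\max_j\big((\underline g_jX_j+\tilde r_j)+\underline s_j\big)},\ \ \frac{n-m}{\sum_j\underline s_j}\right\}.$$
   Context: A linear metro line (no junction) is discretized as a closed loop of $n$ segments; segment $j$ connects nodes $j-1$ and $j$ (indices taken cyclically modulo $n$), and holds at most one train. $b_j\in\{0,1\}$ is the number of trains on segment $j$ at time zero, $\bar b_j=1-b_j$, and $m=\sum_j b_j$ is the number of trains. $d^k_j$ is the $k$-th departure time from node $j$; $h^k_j=d^k_j-d^{k-1}_j$. $\underline s_j$ is the minimum safe separation time, $\underline g_j$ the minimum dynamic interval (time without a train at the platform), $\underline r_j$ the minimum run time, $\tilde r_j=\underline r_j+\Delta r_j$ the nominal run time including the margin $\Delta r_j$. The demand parameter is $x_j=\lambda^{\rm out}_j/\alpha^{\rm out}_j+\lambda^{\rm in}_j/\alpha^{\rm in}_j\in[0,1)$ (average passenger departure/arrival rates over alighting/boarding capacities; $0$ if no platform), $X_j=x_j/(1-x_j)$. The displayed max-plus linear system is the form taken by the train dynamics with travel time $r^k_j+w^k_j$, $w^k_j=\min(x_jh^k_j,\bar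 w_j)$, $r^k_j=\max\{\underline r_j,\tilde r_j-x_j(h^k_j-\underline h_j)\}$ (where $\underline h_j=\underline g_j/(1-x_j)$, $\bar w_j=X_j\bar g_j$, $\bar g_j$ the maximum dynamic interval), under the standing conditions $h^1_j\le\bar g_j/(1-x_j)$ and $\Delta r_j\ge X_j(\bar g_j-\underline g_j)$ for all $j$. The asymptotic average headway is $h=\lim_{k\to\infty}d^k_j/k$, common to all $j$, and the asymptotic average frequency is $f=1/h$. *)

theory Defs
  imports Complex_Main
begin

text \<open>
  Nodes and segments are indexed by \<open>0, \<dots>, n - 1\<close> with \<open>n = num_segs L\<close>; segment \<open>j\<close> joins node
  \<open>pred_node L j\<close> to node \<open>j\<close>. Values of the fields at indices \<open>j \<ge> n\<close> are irrelevant.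
\<close>

record metro_line =
  num_segs :: nat                      (* n *)
  init_trains :: "nat \<Rightarrow> nat"          (* b_j *)
  has_platform :: "nat \<Rightarrow> bool"
  dep_rate :: "nat \<Rightarrow> real"            (* lambda^out_j *)
  arr_rate :: "nat \<Rightarrow> real"            (* lambda^in_j *)
  alight_cap :: "nat \<Rightarrow> real"          (* alpha^out_j *)
  board_cap :: "nat \<Rightarrow> real"           (* alpha^in_j *)
  min_sep :: "nat \<Rightarrow> real"             (* minimum safe separation time s_j *)
  min_dyn_interval :: "nat \<Rightarrow> real"    (* minimum dynamic interval g_j *)
  min_run :: "nat \<Rightarrow> real"             (* minimum run time r_j *)
  run_margin :: "nat \<Rightarrow> real"          (* Delta r_j *)

definition num_trains :: "metro_line \<Rightarrow> nat" where
  "num_trains L = (\<Sum>j<num_segs L. init_trains L j)"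

definition demand_rate :: "metro_line \<Rightarrow> nat \<Rightarrow> real" where  (* x_j *)
  "demand_rate L j =
     (if has_platform L j then dep_rate L j / alight_cap L j + arr_rate L j / board_cap L j else 0)"

definition demand :: "metro_line \<Rightarrow> nat \<Rightarrow> real" where  (* X_j *)
  "demand L j = demand_rate L j / (1 - demand_rate L j)"

definition nominal_run :: "metro_line \<Rightarrow> nat \<Rightarrow> real" where
  "nominal_run L j = min_run L j + run_margin L j"

text \<open>
  Admissible parameter ranges. Strict positivity of the run and separation times makes every
  denominator in the frequency formula nonzero.
\<close>

definition valid_line :: "metro_line \<Rightarrow> bool" where
  "valid_line L \<longleftrightarrow> (\<forall>j<num_segs L.
     init_trains L j \<in> {0, 1} \<and>
     (has_platform L j \<longrightarrow>
        0 \<le> dep_rate L j \<and> 0 \<le> arr_rate L j \<and> 0 < alight_cap L j \<and> 0 < board_cap L j) \<and>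
     demand_rate L j < 1 \<and>
     0 < min_sep L j \<and> 0 \<le> min_dyn_interval L j \<and> 0 < min_run L j \<and> 0 \<le> run_margin L j)"

definition pred_node :: "metro_line \<Rightarrow> nat \<Rightarrow> nat" where
  "pred_node L j = (j + num_segs L - 1) mod num_segs L"

definition succ_node :: "metro_line \<Rightarrow> nat \<Rightarrow> nat" where
  "succ_node L j = (j + 1) mod num_segs L"

text \<open>
  \<open>d k j\<close> is the \<open>k\<close>-th departure time from node \<open>j\<close>. The initial vector \<open>d 0\<close> is arbitrary. The
  equations are implicit, since \<open>d k\<close> also occurs on the right-hand side. The natural-number
  subtractions do not truncate: \<open>k \<ge> 1\<close>, and \<open>init_trains\<close> has values in \<open>{0, 1}\<close>.
\<close>

definition max_plus_trajectory :: "metro_line \<Rightarrow> (nat \<Rightarrow> nat \<Rightarrow> real) \<Rightarrow> bool" where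
  "max_plus_trajectory L d \<longleftrightarrow> (\<forall>k\<ge>1. \<forall>j<num_segs L.
     d k j =
       max (d (k - init_trains L j) (pred_node L j)
              + nominal_run L j + demand L j * min_dyn_interval L j)
           (d (k - (1 - init_trains L (succ_node L j))) (succ_node L j)
              + min_sep L (succ_node L j)))"

definition asymptotic_headway :: "metro_line \<Rightarrow> (nat \<Rightarrow> nat \<Rightarrow> real) \<Rightarrow> real \<Rightarrow> bool" where
  "asymptotic_headway L d h \<longleftrightarrow> (\<forall>j<num_segs L. (\<lambda>k. d k j / real k) \<longlonglongrightarrow> h)"

definition asymptotic_frequency :: "metro_line \<Rightarrow> (nat \<Rightarrow> nat \<Rightarrow> real) \<Rightarrow> real \<Rightarrow> bool" where
  "asymptotic_frequency L d f \<longleftrightarrow> (\<exists>h>0. asymptotic_headway L d h \<and> f = 1 / h)"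

end

theory Submission
  imports Defs
begin

text \<open>
  Write \<open>t j\<close> for the travel time and \<open>s j\<close> for the separation time of segment \<open>j\<close>, and let \<open>h\<close> be
  the largest of \<open>(\<Sum>j. t j) / m\<close>, \<open>Max\<^sub>j (t j + s j)\<close> and \<open>(\<Sum>j. s j) / (n - m)\<close>. These are the
  ratios weight / delay of the circuits that matter: once around the line with the trains, back and
  forth over one segment, and once around the line against the trains. Every
  trajectory stays within a bounded distance of \<open>k * h\<close>, so the headway is \<open>h\<close>.

  No enumeration of circuits is needed, because \<open>h\<close> can be characterised by potentials. A vector
  \<open>v\<close> with increments \<open>u j = v j - v (j - 1)\<close> makes \<open>v j + k * h\<close> a supersolution of the dynamics
  exactly when
  \<open>t j - h * b j \<le> u j \<le> h * (1 - b j) - s j\<close> for all \<open>j\<close>. Around the loop the increments must sum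
  to zero. Such increments exist iff every lower end is below its upper end, the lower
  ends sum to at most zero, and the upper ends sum to at least zero; these three conditions
  say that \<open>h\<close> is at least each of the three ratios (\<open>interpolate_zero_sum\<close>,
  \<open>potential_exists\<close>). The potential yields \<open>d k j \<le> v j + k * h + C\<close> (\<open>upper_bound\<close>).

  Since \<open>h\<close> equals one of the ratios, one of the three conditions holds with equality, which forces
  the constraints to be tight along the corresponding circuit. On that circuit the same potential
  yields \<open>v j + k * h - C \<le> d k j\<close> (\<open>lower_bound_on_critical_set\<close>), and a lower bound
  at one node travels with the trains to all the others (\<open>lower_bound_everywhere\<close>).

  The equations are implicit: \<open>d k j\<close> may refer to other components of \<open>d k\<close>. The induction behind
  both bounds therefore follows time itself: all travel and separation times are positive, so each
  departure is determined by strictly earlier ones (\<open>causal_induct\<close>).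
\<close>

section \<open>Two general facts\<close>

text \<open>
  Within one round \<open>k\<close>, the events of \<open>S\<close> are processed in increasing order of the times \<open>d k\<close>;
  finiteness of \<open>S\<close> makes this order well-founded.
\<close>

lemma causal_induct:
  fixes d :: "nat \<Rightarrow> 'a \<Rightarrow> 'b::order"
  assumes fin: "finite S"
    and base: "\<And>j. j \<in> S \<Longrightarrow> P 0 j"
    and step: "\<And>k j. 1 \<le> k \<Longrightarrow> j \<in> S \<Longrightarrow>
      \<exists>k' i. i \<in> S \<and> (k' < k \<or> k' = k \<and> d k' i < d k j) \<and> (P k' i \<longrightarrow> P k j)"
    and "j \<in> S"
  shows "P k j"
  using \<open>j \<in> S\<close>
proof (induction k arbitrary: j rule: less_induct)
  case (less k)
  note earlier_round = less.IH
  from \<open>j \<in> S\<close> show ?case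
  proof (induction "card {i \<in> S. d k i < d k j}" arbitrary: j rule: less_induct)
    case less
    show ?case
    proof (cases "k = 0")
      case True
      then show ?thesis using base less.prems by simp
    next
      case False
      then obtain k' i where i: "i \<in> S" and before: "k' < k \<or> k' = k \<and> d k' i < d k j"
        and imp: "P k' i \<longrightarrow> P k j"
        using step[of k j] less.prems by auto
      have "P k' i"
        using before
      proof
        assume "k' < k"
        then show ?thesis using earlier_round i by blast
      next
        assume *: "k' = k \<and> d k' i < d k j"
        then have "{l \<in> S. d k l < d k i} \<subset> {l \<in> S. d k l < d k j}"
          using i by (auto dest: less_trans)
        then have "card {l \<in> S. d k l < d k i} < card {l \<in> S. d k l < d k j}"
          using fin by (intro psubset_card_mono) auto
        then show ?thesis using less.hyps i * by blast
      qed
      with imp show ?thesis by blast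
    qed
  qed
qed

text \<open>
  The sum is affine along the segment from \<open>l\<close> to \<open>r\<close>, so it vanishes somewhere on it.
\<close>

lemma interpolate_zero_sum:
  fixes l r :: "'a \<Rightarrow> real"
  assumes le: "\<And>j. j \<in> A \<Longrightarrow> l j \<le> r j"
    and l: "sum l A \<le> 0" and r: "0 \<le> sum r A"
  obtains u where "\<And>j. j \<in> A \<Longrightarrow> l j \<le> u j" "\<And>j. j \<in> A \<Longrightarrow> u j \<le> r j" "sum u A = 0"
proof (cases "sum l A = sum r A")
  case True
  with l r le show ?thesis by (intro that[of l]) auto
next
  case False
  define c where "c = - sum l A / (sum r A - sum l A)"
  have pos: "0 < sum r A - sum l A" using False l r by linarith
  have c: "0 \<le> c" "c \<le> 1" using l r pos by (auto simp: c_def divide_simps)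
  show ?thesis
  proof (rule that[of "\<lambda>j. l j + c * (r j - l j)"])
    fix j assume "j \<in> A"
    then have d: "0 \<le> r j - l j" using le by simp
    then show "l j \<le> l j + c * (r j - l j)" using c by simp
    have "c * (r j - l j) \<le> 1 * (r j - l j)" using c d by (intro mult_right_mono) auto
    then show "l j + c * (r j - l j) \<le> r j" by simp
  next
    have "(\<Sum>j\<in>A. l j + c * (r j - l j)) = sum l A + c * (sum r A - sum l A)"
      by (simp add: sum.distrib sum_subtractf flip: sum_distrib_left)
    also have "\<dots> = 0" using pos by (simp add: c_def)
    finally show "(\<Sum>j\<in>A. l j + c * (r j - l j)) = 0" .
  qed
qed

section \<open>Trajectories of a line\<close>

locale line_trajectory =
  fixes L :: metro_line and d :: "nat \<Rightarrow> nat \<Rightarrow> real"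
  assumes valid: "valid_line L"
    and n_pos: "0 < num_segs L"
    and trajectory: "max_plus_trajectory L d"
begin

abbreviation n :: nat where "n \<equiv> num_segs L"
abbreviation b :: "nat \<Rightarrow> nat" where "b \<equiv> init_trains L"
abbreviation s :: "nat \<Rightarrow> real" where "s \<equiv> min_sep L"
abbreviation prv :: "nat \<Rightarrow> nat" where "prv \<equiv> pred_node L"
abbreviation nxt :: "nat \<Rightarrow> nat" where "nxt \<equiv> succ_node L"

definition t :: "nat \<Rightarrow> real" where
  "t j = min_dyn_interval L j * demand L j + nominal_run L j"

lemma prv_less: "prv j < n"
  using n_pos by (simp add: pred_node_def)

lemma nxt_less: "nxt j < n"
  using n_pos by (simp add: succ_node_def)

lemma prv_nxt: "j < n \<Longrightarrow> prv (nxt j) = j"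
  using n_pos by (cases "Suc j = n") (auto simp: pred_node_def succ_node_def mod_if)

lemma nxt_prv: "j < n \<Longrightarrow> nxt (prv j) = j"
  using n_pos by (cases j) (auto simp: pred_node_def succ_node_def mod_if)

lemma b_cases: "j < n \<Longrightarrow> b j = 0 \<or> b j = 1"
  using valid by (auto simp: valid_line_def)

lemma s_pos: "j < n \<Longrightarrow> 0 < s j"
  using valid by (auto simp: valid_line_def)

lemma t_pos:
  assumes "j < n" shows "0 < t j"
proof -
  have "0 \<le> demand_rate L j" "demand_rate L j < 1"
    using valid assms by (auto simp: valid_line_def demand_rate_def)
  then have "0 \<le> demand L j" by (simp add: demand_def)
  moreover have "0 \<le> min_dyn_interval L j" "0 < min_run L j" "0 \<le> run_margin L j"
    using valid assms by (auto simp: valid_line_def)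
  ultimately show ?thesis
    unfolding t_def nominal_run_def by (intro add_nonneg_pos add_pos_nonneg mult_nonneg_nonneg)
qed

lemma sum_b: "(\<Sum>j<n. real (b j)) = real (num_trains L)"
  by (simp add: num_trains_def)

lemma dynamics:
  assumes "1 \<le> k" "j < n"
  shows "d k j = max (d (k - b j) (prv j) + t j)
                     (d (k - (1 - b (nxt j))) (nxt j) + s (nxt j))"
  using trajectory assms by (simp add: max_plus_trajectory_def t_def algebra_simps)

section \<open>Potentials\<close>

definition potential :: "real \<Rightarrow> (nat \<Rightarrow> real) \<Rightarrow> bool" where
  "potential h v \<longleftrightarrow> (\<forall>j<n. t j - h * b j \<le> v j - v (prv j)
     \<and> v j - v (prv j) \<le> h * (1 - real (b j)) - s j)"

text \<open>
  The partial sums have the right increments away from node \<open>0\<close>; the vanishing total closes the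
  loop there.
\<close>

lemma increments_integrate:
  fixes u :: "nat \<Rightarrow> real"
  assumes "(\<Sum>j<n. u j) = 0" "j < n"
  shows "(\<Sum>i\<le>j. u i) - (\<Sum>i\<le>prv j. u i) = u j"
proof (cases j)
  case 0
  have "{..n - 1} = {..<n}" using n_pos by auto
  with 0 assms n_pos show ?thesis by (simp add: pred_node_def)
next
  case (Suc i)
  then have "prv j = i" using assms by (simp add: pred_node_def)
  with Suc show ?thesis by simp
qed

lemma potential_exists:
  assumes forward: "(\<Sum>j<n. t j) \<le> h * real (num_trains L)"
    and segment: "\<And>j. j < n \<Longrightarrow> t j + s j \<le> h"
    and backward: "(\<Sum>j<n. s j) \<le> h * (real n - real (num_trains L))"
  obtains v where "potential h v"
proof -
  have low: "(\<Sum>j<n. t j - h * b j) \<le> 0"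
    using forward by (simp add: sum_subtractf sum_b flip: sum_distrib_left)
  have high: "0 \<le> (\<Sum>j<n. h * (1 - real (b j)) - s j)"
    using backward by (simp add: sum_subtractf sum_b flip: sum_distrib_left)
  have "t j - h * b j \<le> h * (1 - real (b j)) - s j" if "j \<in> {..<n}" for j
    using segment[of j] that by (simp add: algebra_simps)
  from interpolate_zero_sum[OF this low high]
  obtain u where u: "\<And>j. j \<in> {..<n} \<Longrightarrow> t j - h * b j \<le> u j"
    "\<And>j. j \<in> {..<n} \<Longrightarrow> u j \<le> h * (1 - real (b j)) - s j" "(\<Sum>j<n. u j) = 0"
    by blast
  then have "potential h (\<lambda>j. \<Sum>i\<le>j. u i)"
    by (simp add: potential_def increments_integrate)
  then show ?thesis by (rule that)
qed

text \<open>Along the loop every value of \<open>v\<close> occurs once with each sign.\<close>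

lemma sum_increments: "(\<Sum>j<n. v j - v (prv j)) = (0::real)"
proof -
  have "(\<Sum>j<n. v (prv j)) = (\<Sum>j<n. v j)"
    by (rule sum.reindex_bij_witness[of _ nxt prv])
      (auto simp: prv_less nxt_less prv_nxt nxt_prv)
  then show ?thesis by (simp add: sum_subtractf)
qed

section \<open>Bounds on the departure times\<close>

lemma upper_bound:
  assumes v: "potential h v"
  obtains C where "\<And>k j. j < n \<Longrightarrow> d k j \<le> v j + h * k + C"
proof -
  define C where "C = Max ((\<lambda>j. d 0 j - v j) ` {..<n})"
  have "d k j \<le> v j + h * k + C" if "j < n" for k j
  proof (rule causal_induct[where S = "{..<n}" and d = d
        and P = "\<lambda>k j. d k j \<le> v j + h * real k + C"])
    fix j assume "j \<in> {..<n}"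
    then have "d 0 j - v j \<le> C" unfolding C_def by (intro Max_ge) auto
    then show "d 0 j \<le> v j + h * real 0 + C" by simp
  next
    fix k j assume k: "(1::nat) \<le> k" and j': "j \<in> {..<n}"
    then have j: "j < n" by simp
    \<comment> \<open>Follow whichever term attains the maximum.\<close>
    from dynamics[OF k j] consider
      "d k j = d (k - b j) (prv j) + t j"
      | "d k j = d (k - (1 - b (nxt j))) (nxt j) + s (nxt j)"
      by (auto simp: max_def split: if_splits)
    then show "\<exists>k' i. i \<in> {..<n} \<and> (k' < k \<or> k' = k \<and> d k' i < d k j) \<and>
      (d k' i \<le> v i + h * real k' + C \<longrightarrow> d k j \<le> v j + h * real k + C)"
    proof cases
      case 1
      have "t j - h * b j \<le> v j - v (prv j)" using v j by (simp add: potential_def)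
      then show ?thesis
        using 1 b_cases[OF j] t_pos[OF j] k prv_less[of j]
        by (intro exI[of _ "k - b j"] exI[of _ "prv j"]) (auto simp: of_nat_diff algebra_simps)
    next
      case 2
      have "v (nxt j) - v j \<le> h * (1 - real (b (nxt j))) - s (nxt j)"
        using v nxt_less[of j] prv_nxt[OF j] by (auto simp: potential_def)
      then show ?thesis
        using 2 b_cases[OF nxt_less[of j]] s_pos[OF nxt_less[of j]] k nxt_less[of j]
        by (intro exI[of _ "k - (1 - b (nxt j))"] exI[of _ "nxt j"])
          (auto simp: of_nat_diff algebra_simps)
    qed
  qed (use that in auto)
  then show ?thesis by (rule that)
qed

text \<open>
  \<open>S\<close> plays the role of a union of critical circuits: going back along tight constraints
  never leaves it, and \<open>d k j - v j - h * k\<close> does not increase on the way.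
\<close>

lemma lower_bound_on_critical_set:
  fixes h :: real and v :: "nat \<Rightarrow> real"
  assumes S: "S \<subseteq> {..<n}" "S \<noteq> {}"
    and tight: "\<And>j. j \<in> S \<Longrightarrow>
      prv j \<in> S \<and> v j - v (prv j) = t j - h * b j \<or>
      nxt j \<in> S \<and> v (nxt j) - v j = h * (1 - real (b (nxt j))) - s (nxt j)"
  obtains C where "\<And>k j. j \<in> S \<Longrightarrow> v j + h * k - C \<le> d k j"
proof -
  have fin: "finite S" using S finite_subset by blast
  define C where "C = Max ((\<lambda>j. v j - d 0 j) ` S)"
  have "v j + h * k - C \<le> d k j" if "j \<in> S" for k j
  proof (rule causal_induct[where S = S and d = d
        and P = "\<lambda>k j. v j + h * real k - C \<le> d k j"])
    fix j assume "j \<in> S"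
    then have "v j - d 0 j \<le> C" unfolding C_def using fin by (intro Max_ge) auto
    then show "v j + h * real 0 - C \<le> d 0 j" by simp
  next
    fix k j assume k: "(1::nat) \<le> k" and jS: "j \<in> S"
    then have j: "j < n" using S by auto
    from tight[OF jS]
    show "\<exists>k' i. i \<in> S \<and> (k' < k \<or> k' = k \<and> d k' i < d k j) \<and>
      (v i + h * real k' - C \<le> d k' i \<longrightarrow> v j + h * real k - C \<le> d k j)"
    proof
      assume 1: "prv j \<in> S \<and> v j - v (prv j) = t j - h * b j"
      have "d (k - b j) (prv j) + t j \<le> d k j" using dynamics[OF k j] by simp
      then show ?thesis
        using 1 b_cases[OF j] t_pos[OF j] k
        by (intro exI[of _ "k - b j"] exI[of _ "prv j"]) (auto simp: of_nat_diff algebra_simps)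
    next
      assume 2: "nxt j \<in> S \<and> v (nxt j) - v j = h * (1 - real (b (nxt j))) - s (nxt j)"
      have "d (k - (1 - b (nxt j))) (nxt j) + s (nxt j) \<le> d k j" using dynamics[OF k j] by simp
      then show ?thesis
        using 2 b_cases[OF nxt_less[of j]] s_pos[OF nxt_less[of j]] k
        by (intro exI[of _ "k - (1 - b (nxt j))"] exI[of _ "nxt j"])
          (auto simp: of_nat_diff algebra_simps)
    qed
  qed (use that fin in auto)
  then show ?thesis by (rule that)
qed

text \<open>
  A departure from a node follows a departure from the preceding node whose index is the same or
  one less, so passing to the next node costs at most one more headway. The initial times, about
  which the dynamics says nothing, only enlarge the constant.
\<close>

lemma lower_bound_everywhere:
  assumes h: "0 \<le> h" and i: "i < n" and low: "\<exists>C. \<forall>k. h * real k - C \<le> d k i" and j: "j < n"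
  shows "\<exists>C. \<forall>k. h * real k - C \<le> d k j"
proof -
  have propagate: "\<exists>C. \<forall>k. h * real k - C \<le> d k (nxt l)"
    if l: "l < n" and low: "\<exists>C. \<forall>k. h * real k - C \<le> d k l" for l
  proof -
    obtain C where C: "\<And>k. h * real k - C \<le> d k l" using low by blast
    have "h * real k - max (C + h) (- d 0 (nxt l)) \<le> d k (nxt l)" for k
    proof (cases "k = 0")
      case False
      then have "d (k - b (nxt l)) l + t (nxt l) \<le> d k (nxt l)"
        using dynamics[of k "nxt l"] nxt_less[of l] prv_nxt[OF l] by simp
      then show ?thesis
        using C[of "k - b (nxt l)"] b_cases[OF nxt_less[of l]] t_pos[OF nxt_less[of l]] False h
        by (auto simp: of_nat_diff algebra_simps)
    qed simp
    then show ?thesis by blast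
  qed
  have "\<exists>C. \<forall>k. h * real k - C \<le> d k ((i + q) mod n)" for q
  proof (induction q)
    case 0
    then show ?case using low i by simp
  next
    case (Suc q)
    have "nxt ((i + q) mod n) = (i + Suc q) mod n" by (simp add: succ_node_def mod_Suc_eq)
    with propagate[OF _ Suc] show ?case using n_pos by simp
  qed
  from this[of "j + n - i"] show ?thesis using i j by simp
qed

section \<open>The asymptotic headway\<close>

text \<open>
  The equality hypothesis says that \<open>h\<close> is the least value for which \<open>potential_exists\<close> applies.
  It makes one family of constraints tight: all lower ends, all upper ends, or both ends at one
  segment \<open>j\<close>, whose two end nodes then form the critical set.
\<close>

lemma headway_of_critical_value:
  assumes h: "0 \<le> h"
    and forward: "(\<Sum>j<n. t j) \<le> h * real (num_trains L)"
    and segment: "\<And>j. j < n \<Longrightarrow> t j + s j \<le> h"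
    and backward: "(\<Sum>j<n. s j) \<le> h * (real n - real (num_trains L))"
    and critical: "(\<Sum>j<n. t j) = h * real (num_trains L) \<or> (\<exists>j<n. t j + s j = h)
      \<or> (\<Sum>j<n. s j) = h * (real n - real (num_trains L))"
  shows "asymptotic_headway L d h"
proof -
  obtain v where v: "potential h v"
    using potential_exists forward segment backward by blast
  have lo: "t j - h * b j \<le> v j - v (prv j)"
    and hi: "v j - v (prv j) \<le> h * (1 - real (b j)) - s j" if "j < n" for j
    using v that by (auto simp: potential_def)

  obtain S where S: "S \<subseteq> {..<n}" "S \<noteq> {}" and
    tight: "\<And>j. j \<in> S \<Longrightarrow>
      prv j \<in> S \<and> v j - v (prv j) = t j - h * b j \<or>
      nxt j \<in> S \<and> v (nxt j) - v j = h * (1 - real (b (nxt j))) - s (nxt j)"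
    using critical
  proof (elim disjE exE conjE)
    assume "(\<Sum>j<n. t j) = h * real (num_trains L)"
    then have sum0: "(\<Sum>j<n. t j - h * b j) = (\<Sum>j<n. v j - v (prv j))"
      by (simp add: sum_increments) (simp add: sum_subtractf sum_b flip: sum_distrib_left)
    have "t j - h * b j = v j - v (prv j)" if "j < n" for j
      by (rule sum_mono_inv[OF sum0]) (use lo that in auto)
    then show ?thesis
      using n_pos prv_less by (intro that[of "{..<n}"]) auto
  next
    fix j assume j: "j < n" and "t j + s j = h"
    then have eq: "t j - h * b j = v j - v (prv j)"
      "v j - v (prv j) = h * (1 - real (b j)) - s j"
      using lo[OF j] hi[OF j] by (auto simp: algebra_simps)
    then show ?thesis
      using j prv_less nxt_prv[OF j] by (intro that[of "{j, prv j}"]) auto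
  next
    assume "(\<Sum>j<n. s j) = h * (real n - real (num_trains L))"
    then have sum0: "(\<Sum>j<n. v j - v (prv j)) = (\<Sum>j<n. h * (1 - real (b j)) - s j)"
      by (simp add: sum_increments) (simp add: sum_subtractf sum_b flip: sum_distrib_left)
    have "v j - v (prv j) = h * (1 - real (b j)) - s j" if "j < n" for j
      by (rule sum_mono_inv[OF sum0]) (use hi that in auto)
    then have "v (nxt j) - v j = h * (1 - real (b (nxt j))) - s (nxt j)" if "j < n" for j
      using nxt_less[of j] prv_nxt[OF that] by metis
    then show ?thesis
      using n_pos nxt_less by (intro that[of "{..<n}"]) auto
  qed

  obtain i where i: "i \<in> S" "i < n" using S by auto
  obtain C where C: "\<And>k j. j \<in> S \<Longrightarrow> v j + h * real k - C \<le> d k j"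
    using lower_bound_on_critical_set[OF S tight] by blast
  have "h * real k - (C - v i) \<le> d k i" for k using C[OF i(1), of k] by simp
  then have low: "\<exists>C. \<forall>k. h * real k - C \<le> d k i" by blast
  obtain C' where C': "\<And>k j. j < n \<Longrightarrow> d k j \<le> v j + h * real k + C'"
    using upper_bound[OF v] by blast

  show ?thesis
    unfolding asymptotic_headway_def
  proof (intro allI impI)
    fix j assume j: "j < n"
    obtain A where A: "\<And>k. h * real k - A \<le> d k j"
      using lower_bound_everywhere[OF h i(2) low j] by blast
    have above: "(\<lambda>k. h + (v j + C') / real k) \<longlonglongrightarrow> h"
      and below: "(\<lambda>k. h - A / real k) \<longlonglongrightarrow> h"
      using tendsto_add[OF tendsto_const lim_const_over_n, of h "v j + C'"]
        tendsto_diff[OF tendsto_const lim_const_over_n, of h A] by simp_all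
    show "(\<lambda>k. d k j / real k) \<longlonglongrightarrow> h"
    proof (rule tendsto_sandwich[OF _ _ below above])
      show "\<forall>\<^sub>F k in sequentially. h - A / real k \<le> d k j / real k"
        using eventually_gt_at_top[of 0]
      proof eventually_elim
        case (elim k)
        then show ?case
          using divide_right_mono[OF A, of "real k" k] by (simp add: diff_divide_distrib)
      qed
      show "\<forall>\<^sub>F k in sequentially. d k j / real k \<le> h + (v j + C') / real k"
        using eventually_gt_at_top[of 0]
      proof eventually_elim
        case (elim k)
        then show ?case using C'[OF j, of k] by (simp add: field_simps)
      qed
    qed
  qed
qed

end

theorem corollary2:
  fixes L :: metro_line and d :: "nat \<Rightarrow> nat \<Rightarrow> real" and n m :: nat
  assumes "valid_line L"
    and "n = num_segs L" and "m = num_trains L"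
    and "0 < m" and "m < n"
    and "max_plus_trajectory L d"
  shows "asymptotic_frequency L d
    (Min {real m / (\<Sum>j<n. min_dyn_interval L j * demand L j + nominal_run L j),
          1 / Max ((\<lambda>j. (min_dyn_interval L j * demand L j + nominal_run L j) + min_sep L j) ` {..<n}),
          (real n - real m) / (\<Sum>j<n. min_sep L j)})"
proof -
  interpret line_trajectory L d
    using assms by unfold_locales auto
  define T where "T = (\<Sum>j<n. t j)"
  define U where "U = (\<Sum>j<n. s j)"
  define M where "M = Max ((\<lambda>j. t j + s j) ` {..<n})"
  define h where "h = max (T / m) (max M (U / (real n - real m)))"
  have ne: "{..<n} \<noteq> {}" and m: "0 < real m" "0 < real n - real m" using assms by auto
  have T: "0 < T" unfolding T_def using ne assms(2) t_pos by (intro sum_pos) auto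
  have U: "0 < U" unfolding U_def using ne assms(2) s_pos by (intro sum_pos) auto
  have M_ge: "t j + s j \<le> M" if "j < n" for j
    unfolding M_def using that by (intro Max_ge) auto
  have "M \<in> (\<lambda>j. t j + s j) ` {..<n}" unfolding M_def using ne by (intro Max_in) auto
  then obtain j0 where j0: "j0 < n" "t j0 + s j0 = M" by auto
  then have M: "0 < M" using t_pos[of j0] s_pos[of j0] assms(2) by simp
  have h_pos: "0 < h" using M by (simp add: h_def less_max_iff_disj)
  have h_ge: "T / m \<le> h" "M \<le> h" "U / (real n - real m) \<le> h" by (auto simp: h_def)
  have h_cases: "T / m = h \<or> M = h \<or> U / (real n - real m) = h" by (auto simp: h_def max_def)
  have "asymptotic_headway L d h"
  proof (rule headway_of_critical_value)
    show "(\<Sum>j<num_segs L. t j) \<le> h * real (num_trains L)"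
      using h_ge(1) m by (simp add: assms(2,3)[symmetric] T_def[symmetric] field_simps)
    show "(\<Sum>j<num_segs L. s j) \<le> h * (real (num_segs L) - real (num_trains L))"
      using h_ge(3) m by (simp add: assms(2,3)[symmetric] U_def[symmetric] pos_divide_le_eq)
    show "t j + s j \<le> h" if "j < num_segs L" for j
      using M_ge[of j] h_ge(2) that assms(2) by simp
    show "(\<Sum>j<num_segs L. t j) = h * real (num_trains L) \<or> (\<exists>j<num_segs L. t j + s j = h)
      \<or> (\<Sum>j<num_segs L. s j) = h * (real (num_segs L) - real (num_trains L))"
      using h_cases m j0
      by (auto simp: assms(2,3)[symmetric] T_def[symmetric] U_def[symmetric])
  qed (use h_pos in simp)
  moreover have "Min {m / T, 1 / M, (real n - real m) / U} = 1 / h"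
  proof (rule Min_eqI)
    show "1 / h \<in> {m / T, 1 / M, (real n - real m) / U}"
      using h_cases by auto
    have "1 / h \<le> 1 / (T / m)" "1 / h \<le> 1 / M" "1 / h \<le> 1 / (U / (real n - real m))"
      using h_ge m T M U by (intro frac_le; simp)+
    then show "1 / h \<le> y" if "y \<in> {m / T, 1 / M, (real n - real m) / U}" for y
      using that by auto
  qed simp
  ultimately have "asymptotic_frequency L d (Min {m / T, 1 / M, (real n - real m) / U})"
    unfolding asymptotic_frequency_def using h_pos by auto
  then show ?thesis by (simp add: T_def U_def M_def t_def)
qed

end
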